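(* Let $\kappa,n,m_0\in\mathbb{N}$ be such that there exists a $\kappa$-connected path-complete graph of order $n$ and size at least $m_0$, and let $PK_{n,m_0,\kappa}$ be the one of minimum size among these. Let $D$ be a $\kappa$-connected Eulerian digraph of order $n$ and size at least $2m_0$. Then $$\rho(D)\le \rho(\overleftrightarrow{PK_{n,m_0,\kappa}})=\frac{n}{2\kappa}+2-\frac{1}{\kappa}-\frac{\kappa-1}{n-1}-\frac{m_0}{\kappa(n-1)}.$$ The bound is sharp if $m_0\equiv\binom{n-1}{2}\pmod{\kappa}$ and $$\frac12\left[n(3\kappa-1)-2\kappa^2-\kappa+1-b(\kappa-b)\right]\le m_0\le\binom{n-1}{2},$$ where $b$ is the integer in $\{1,2,\ldots,\kappa\}$ with $b\equiv\binom{n-1}{2}\pmod{\kappa}$.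
   Context: Graphs and digraphs are finite, without loops or multiple edges/arcs (opposite arcs are allowed). $\mathbb{N}$ denotes the positive integers. Order is the number of vertices; size is the number of edges of a graph, respectively arcs of a digraph. A digraph is strong if there is a directed path between every ordered pair of vertices. An Eulerian digraph is a strong digraph that contains an Eulerian circuit (a closed directed trail using every arc). The vertex-connectivity of a digraph is the minimum number of vertices whose removal results in a digraph that is not strong; a digraph is $\kappa$-connected if its vertex-connectivity is at least $\kappa$. For a strong digraph $D$ of order $n\ge2$, the remoteness is $\rho(D)=\max_{v\in V(D)}\frac{1}{n-1}\sum_{w\in V(D)}d_D(v,w)$, where $d_D(v,w)$ is the length of a shortest directed path from $v$ to $w$. For a graph $G$, $\overleftrightarrow{G}$ is the digraph obtained by replacing each edge by two arcs in opposite directions. For disjoint graphs $G_1,\ldots,G_k$, the sequential sum $G_1+\cdots+G_k$ is obtained from their union by joining every vertex of $G_i$ to every vertex of $G_{i+1}$, $i=1,\ldots,k-1$. A $\kappa$-connected path-complete graph is a graph of the form $K_1+[K_\kappa]^{\ell}+K_a+K_b$ with $\ell,a,b\in\mathbb{N}$, $a\ge\kappa$ (here $b$ is a parameter of the construction), where $K_r$ is the complete graph on $r$ vertices and $[K_\kappa]^{\ell}$ stands for $\ell$ consecutive terms $K_\kappa+\cdots+K_\kappa$.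
   Formalization: The displayed equality is proved with the size of PK in place of m_0 (with m_0 it is only an upper bound, equality holding in the sharpness range), and b is taken congruent to n-1, not binom(n-1,2), mod κ; as printed both claims fail (κ=2, n=6, m_0=1; κ=8, n=25, m_0=212). *)

theory Defs
  imports
    Complex_Main
    "HOL-Number_Theory.Cong"
    "Graph_Theory.Graph_Theory"
begin

text \<open>
  Digraphs are those of \<^theory>\<open>Graph_Theory.Digraph\<close>: the locale \<^locale>\<open>digraph\<close> says finite, without
  loops and without parallel arcs; opposite arcs are allowed. Order and size are \<open>card (verts D)\<close>
  and \<open>card (arcs D)\<close>.
\<close>

definition eulerian_digraph :: "('a, 'b) pre_digraph \<Rightarrow> bool" where
  "eulerian_digraph D \<longleftrightarrow>
     digraph D \<and> strongly_connected D \<and> (\<exists>u p. pre_digraph.euler_trail D u p u)"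

text \<open>
  In the library the empty digraph is not strongly connected, so the minimum below always exists.
  The only digraphs for which no proper subset of the vertices separates are those with arcs in
  both directions between any two vertices; they get the value \<open>n\<close> instead of the other usual
  convention \<open>n - 1\<close>. For \<open>\<kappa>\<close>-connectivity of digraphs of order greater than \<open>\<kappa>\<close> this makes no
  difference.
\<close>

definition vertex_connectivity :: "('a, 'b) pre_digraph \<Rightarrow> nat" where
  "vertex_connectivity D =
     (LEAST k. \<exists>S \<subseteq> verts D. card S = k \<and> \<not> strongly_connected (D \<restriction> (verts D - S)))"

definition k_connected :: "nat \<Rightarrow> ('a, 'b) pre_digraph \<Rightarrow> bool" where
  "k_connected \<kappa> D \<longleftrightarrow> \<kappa> \<le> vertex_connectivity D"

definition path_dist :: "('a, 'b) pre_digraph \<Rightarrow> 'a \<Rightarrow> 'a \<Rightarrow> nat" where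
  "path_dist D v w = (LEAST k. \<exists>p. pre_digraph.apath D v p w \<and> length p = k)"

definition remoteness :: "('a, 'b) pre_digraph \<Rightarrow> real" where
  "remoteness D =
     Max ((\<lambda>v. 1 / (real (card (verts D)) - 1) * (\<Sum>w\<in>verts D. real (path_dist D v w))) ` verts D)"

text \<open>
  The library has undirected graphs only as symmetric digraphs. Here edges are two-element sets,
  so that the size of a graph counts each edge once.
\<close>

record 'v ugraph =
  uverts :: "'v set"
  uedges :: "'v set set"

definition usize :: "'v ugraph \<Rightarrow> nat" where
  "usize G = card (uedges G)"

definition complete_graph :: "nat \<Rightarrow> 'v ugraph \<Rightarrow> bool" where
  "complete_graph r G \<longleftrightarrow>
     finite (uverts G) \<and> card (uverts G) = r \<and> uedges G = {e. e \<subseteq> uverts G \<and> card e = 2}"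

definition pairwise_disjoint :: "'v ugraph list \<Rightarrow> bool" where
  "pairwise_disjoint Gs \<longleftrightarrow>
     (\<forall>i j. i < j \<and> j < length Gs \<longrightarrow> uverts (Gs ! i) \<inter> uverts (Gs ! j) = {})"

definition sequential_sum :: "'v ugraph list \<Rightarrow> 'v ugraph" where
  "sequential_sum Gs =
     \<lparr> uverts = (\<Union>G\<in>set Gs. uverts G),
       uedges = (\<Union>G\<in>set Gs. uedges G) \<union>
         {{u, v} | i u v. Suc i < length Gs \<and> u \<in> uverts (Gs ! i) \<and> v \<in> uverts (Gs ! Suc i)} \<rparr>"

definition path_complete :: "nat \<Rightarrow> 'v ugraph \<Rightarrow> bool" where
  "path_complete \<kappa> G \<longleftrightarrow>
     (\<exists>l a b Gs. 1 \<le> l \<and> 1 \<le> a \<and> 1 \<le> b \<and> \<kappa> \<le> a \<and>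
        list_all2 complete_graph ([1] @ replicate l \<kappa> @ [a, b]) Gs \<and>
        pairwise_disjoint Gs \<and> G = sequential_sum Gs)"

definition bidirected :: "'v ugraph \<Rightarrow> ('v, 'v \<times> 'v) pre_digraph" where
  "bidirected G = \<lparr> verts = uverts G, arcs = {(u, v). {u, v} \<in> uedges G}, tail = fst, head = snd \<rparr>"

text \<open>
  \<open>is_PK \<kappa> n m G\<close>: \<open>G\<close> is a \<open>\<kappa>\<close>-connected path-complete graph of minimum size among those of order
  \<open>n\<close> and size at least \<open>m\<close>. Comparing only with graphs on the same vertex type loses nothing: this
  type has at least \<open>n\<close> elements, so it contains a copy of every graph of order \<open>n\<close>.
\<close>

definition is_PK :: "nat \<Rightarrow> nat \<Rightarrow> nat \<Rightarrow> 'v ugraph \<Rightarrow> bool" where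
  "is_PK \<kappa> n m G \<longleftrightarrow>
     is_arg_min usize (\<lambda>H. path_complete \<kappa> H \<and> card (uverts H) = n \<and> m \<le> usize H) G"

text \<open>
  On the closed form of the remoteness of \<open>PK\<close>, the minimiser for \<open>m\<close>. Its remoteness is
  \<open>rem_bound \<kappa> n (usize PK)\<close>, and this is \<open>rem_bound \<kappa> n m\<close> precisely when the size of \<open>PK\<close> is
  \<open>m\<close> itself; otherwise it is smaller. (For \<open>\<kappa> = 2\<close>, \<open>n = 6\<close> the only path-complete graph is
  \<open>K\<^sub>1 + K\<^sub>2 + K\<^sub>2 + K\<^sub>1\<close>, of size 10, and it is the minimiser for every \<open>m\<close> from 1 to 10.)
  The sizes of the path-complete graphs of order \<open>n\<close> are the numbers congruent to \<open>(n-1) choose 2\<close>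
  modulo \<open>\<kappa>\<close> from \<open>(n(3\<kappa>-1) - 2\<kappa>\<^sup>2 - \<kappa> + 1 - b(\<kappa>-b)) / 2\<close> to \<open>(n-1) choose 2\<close>, where
  \<open>b \<in> {1..\<kappa>}\<close> is congruent to \<open>n-1\<close>: the smallest of these graphs is
  \<open>K\<^sub>1 + [K\<^sub>\<kappa>]\<^sup>l + K\<^sub>\<kappa> + K\<^sub>b\<close>. The residue of \<open>(n-1) choose 2\<close> in place of that of \<open>n-1\<close> would be
  wrong for \<open>b\<close>: with \<open>\<kappa> = 8\<close>, \<open>n = 25\<close> it would admit \<open>m = 212\<close>, whereas the smallest size is 220.
\<close>

definition rem_bound :: "nat \<Rightarrow> nat \<Rightarrow> nat \<Rightarrow> real" where
  "rem_bound \<kappa> n m =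
     real n / (2 * real \<kappa>) + 2 - 1 / real \<kappa> - (real \<kappa> - 1) / (real n - 1)
       - real m / (real \<kappa> * (real n - 1))"

definition admissible :: "nat \<Rightarrow> nat \<Rightarrow> nat \<Rightarrow> ('a, 'b) pre_digraph \<Rightarrow> bool" where
  "admissible \<kappa> n m D \<longleftrightarrow>
     eulerian_digraph D \<and> k_connected \<kappa> D \<and> card (verts D) = n \<and> 2 * m \<le> card (arcs D)"

end

theory Submission
  imports Defs
begin

text \<open>
  Partition the vertices by their distance from a vertex realising the remoteness, and let \<open>T\<close> be
  the sum of the distances. An arc raises the distance by at most one, and in a balanced digraph
  the changes of distance along all arcs add up to zero. So there are at most as many arcs going
  down as going up, and the number of arcs is at most the number of ordered pairs of distinct
  vertices whose distances differ by at most one. By \<open>\<kappa>\<close>-connectivity every layer strictly between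
  the first and the last has at least \<open>\<kappa>\<close> vertices. Hence a vertex \<open>w\<close> at distance \<open>j \<ge> 2\<close> has at
  least \<open>1 + \<kappa>(j - 2)\<close> vertices that are lower by two or more, and summing this over \<open>w\<close> bounds
  \<open>2\<kappa>T\<close> plus the number of arcs by a constant depending only on \<open>\<kappa>\<close> and \<open>n\<close>. For path-complete
  graphs all these inequalities are equalities, so in this class increasing \<open>T\<close> by one decreases
  the size by exactly \<open>\<kappa>\<close>. Such a step is possible (move a vertex one layer up) except for
  \<open>K\<^sub>1 + [K\<^sub>\<kappa>]\<^sup>l + K\<^sub>\<kappa> + K\<^sub>b\<close> with \<open>b \<le> \<kappa>\<close>, where \<open>T\<close> is the largest possible for the given layer
  sizes. Therefore no digraph of size at least \<open>2m\<^sub>0\<close> beats the path-complete minimiser.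
\<close>

section \<open>Layered vertex sets\<close>

definition level :: "'v set \<Rightarrow> ('v \<Rightarrow> nat) \<Rightarrow> nat \<Rightarrow> 'v set" where
  "level V lev i = {w \<in> V. lev w = i}"

text \<open>Pairs are ordered, so their number is twice the number of edges of a graph and compares
  directly with the number of arcs of a digraph.\<close>

definition close_pairs :: "'v set \<Rightarrow> ('v \<Rightarrow> nat) \<Rightarrow> ('v \<times> 'v) set" where
  "close_pairs V lev = {(u, w) \<in> V \<times> V. u \<noteq> w \<and> lev u \<le> lev w + 1 \<and> lev w \<le> lev u + 1}"

text \<open>Twice the common value of \<open>\<kappa>T\<close> plus the size over the path-complete graphs of order \<open>n\<close>.\<close>

definition size_const :: "nat \<Rightarrow> nat \<Rightarrow> int" where
  "size_const \<kappa> n =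
     int n * (int n - 1) + 2 * (2 * int \<kappa> - 1) * (int n - 1) - 2 * int \<kappa> * (int \<kappa> - 1)"

section \<open>Counting pairs of vertices by level\<close>

lemma finite_level [simp]: "finite V \<Longrightarrow> finite (level V lev i)"
  by (simp add: level_def)

lemma card_lower_Suc:
  assumes "finite V"
  shows "card {u \<in> V. lev u < Suc j} = card {u \<in> V. lev u < j} + card (level V lev j)"
proof -
  have "{u \<in> V. lev u < Suc j} = {u \<in> V. lev u < j} \<union> level V lev j"
    by (auto simp: level_def)
  then show ?thesis
    using assms by (simp add: card_Un_disjoint level_def disjoint_iff)
qed

text \<open>The ordered pairs split into close pairs, pairs climbing by two or more, the mirror
  images of the latter, and the diagonal.\<close>

lemma card_close_pairs:
  assumes "finite V"
  shows "card (close_pairs V lev) + 2 * (\<Sum>w\<in>V. card {u \<in> V. lev u + 2 \<le> lev w}) + card V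
    = card V * card V"
proof -
  define F where "F = {(u, w) \<in> V \<times> V. lev u + 2 \<le> lev w}"
  have fin: "finite (V \<times> V)" using assms by simp
  have subF: "F \<subseteq> V \<times> V" and subC: "close_pairs V lev \<subseteq> V \<times> V"
    by (auto simp: F_def close_pairs_def)
  have finF: "finite F" and finC: "finite (close_pairs V lev)"
    using subF subC fin finite_subset by blast+
  have "bij_betw prod.swap (SIGMA w:V. {u \<in> V. lev u + 2 \<le> lev w}) F"
    by (rule bij_betwI[where g = prod.swap]) (auto simp: F_def)
  then have F: "card F = (\<Sum>w\<in>V. card {u \<in> V. lev u + 2 \<le> lev w})"
    using assms by (simp add: bij_betw_same_card[symmetric])
  have swap: "card (prod.swap ` F) = card F"
    by (intro card_image) (auto simp: inj_on_def)
  have diag: "card ((\<lambda>w. (w, w)) ` V) = card V"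
    by (intro card_image) (auto simp: inj_on_def)
  have "V \<times> V = close_pairs V lev \<union> (F \<union> (prod.swap ` F \<union> (\<lambda>w. (w, w)) ` V))"
    by (auto simp: F_def close_pairs_def image_iff not_le not_less_eq_eq)
  then have "card (V \<times> V) = card (close_pairs V lev \<union> (F \<union> (prod.swap ` F \<union> (\<lambda>w. (w, w)) ` V)))"
    by simp
  also have "\<dots> = card (close_pairs V lev) + (card F + (card F + card V))"
  proof -
    have "prod.swap ` F \<inter> (\<lambda>w. (w, w)) ` V = {}" by (auto simp: F_def)
    then have 1: "card (prod.swap ` F \<union> (\<lambda>w. (w, w)) ` V) = card F + card V"
      using swap diag finF assms by (simp add: card_Un_disjoint)
    have "F \<inter> (prod.swap ` F \<union> (\<lambda>w. (w, w)) ` V) = {}" by (auto simp: F_def)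
    then have 2: "card (F \<union> (prod.swap ` F \<union> (\<lambda>w. (w, w)) ` V)) = card F + (card F + card V)"
      using 1 finF assms by (simp add: card_Un_disjoint)
    have "close_pairs V lev \<inter> (F \<union> (prod.swap ` F \<union> (\<lambda>w. (w, w)) ` V)) = {}"
      by (auto simp: F_def close_pairs_def)
    then show ?thesis
      using 2 finF finC assms by (simp add: card_Un_disjoint)
  qed
  finally show ?thesis
    using F by (simp add: card_cartesian_product)
qed

text \<open>Charging each far pair to its higher vertex turns the quantity to be bounded into a sum
  of one weight per vertex, which can be estimated vertex by vertex.\<close>

lemma sum_lev_close_pairs:
  assumes "finite V"
  shows "2 * k * (\<Sum>w\<in>V. int (lev w)) + int (card (close_pairs V lev))
    = int (card V) * (int (card V) - 1)
      + 2 * (\<Sum>w\<in>V. k * int (lev w) - int (card {u \<in> V. lev u + 2 \<le> lev w}))"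
proof -
  define M where "M w = card {u \<in> V. lev u + 2 \<le> lev w}" for w
  have "int (card (close_pairs V lev) + 2 * (\<Sum>w\<in>V. M w) + card V) = int (card V * card V)"
    using card_close_pairs[OF assms, of lev] by (simp only: M_def)
  moreover have "(\<Sum>w\<in>V. k * int (lev w) - int (M w))
      = k * (\<Sum>w\<in>V. int (lev w)) - (\<Sum>w\<in>V. int (M w))"
    by (simp add: sum_subtractf sum_distrib_left)
  ultimately show ?thesis
    unfolding M_def[symmetric] by (simp add: algebra_simps)
qed

text \<open>Adds up the weights that are upper bounds in \<open>weight_le\<close> and exact in
  \<open>weight_eq\<close>. They distinguish only the levels 0, 1 and at least 2, so only the sizes
  of the first two layers enter.\<close>

lemma sum_level_weights:
  fixes x y :: int
  assumes "finite V"
  shows "(\<Sum>w\<in>V. if lev w = 0 then 0 else if lev w = 1 then y else x) =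
    x * int (card V) - x * int (card (level V lev 0)) - (x - y) * int (card (level V lev 1))"
proof -
  have ind: "(\<Sum>w\<in>V. of_bool (lev w = i)) = int (card (level V lev i))" for i
    using assms by (simp add: level_def Int_def)
  have "(\<Sum>w\<in>V. if lev w = 0 then 0 else if lev w = 1 then y else x) =
    (\<Sum>w\<in>V. x - x * of_bool (lev w = 0) - (x - y) * of_bool (lev w = 1))"
    by (intro sum.cong) auto
  also have "\<dots> = x * int (card V) - x * int (card (level V lev 0))
      - (x - y) * int (card (level V lev 1))"
    by (simp only: sum_subtractf sum_distrib_left[symmetric] ind) simp
  finally show ?thesis .
qed

text \<open>Covers both the distance layers of a \<kappa>-connected digraph and the levels of a
  path-complete graph. The last layer need only be nonempty, because it separates nothing.\<close>

locale layering =
  fixes V :: "'v set" and lev :: "'v \<Rightarrow> nat" and \<kappa> d :: nat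
  assumes finite_V: "finite V"
    and \<kappa>_pos: "1 \<le> \<kappa>"
    and card_level_0: "card (level V lev 0) = 1"
    and card_level: "\<And>i. 0 < i \<Longrightarrow> i < d \<Longrightarrow> \<kappa> \<le> card (level V lev i)"
    and level_le: "\<And>w. w \<in> V \<Longrightarrow> lev w \<le> d"
    and level_top: "level V lev d \<noteq> {}"
begin

lemma card_lower: "Suc j \<le> d \<Longrightarrow> 1 + \<kappa> * j \<le> card {u \<in> V. lev u < Suc j}"
proof (induction j)
  case 0
  then show ?case using card_level_0 by (simp add: level_def)
next
  case (Suc j)
  then show ?case
    using card_lower_Suc[OF finite_V, of lev "Suc j"] card_level[of "Suc j"] by simp
qed

text \<open>For \<open>d \<le> 1\<close> the bound on intermediate layers says nothing about layer
  1, but then that layer holds every vertex except the root.\<close>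

lemma card_level_1:
  assumes "\<kappa> < card V"
  shows "\<kappa> \<le> card (level V lev 1)"
proof (cases "1 < d")
  case True
  then show ?thesis using card_level by simp
next
  case False
  then have "V = {u \<in> V. lev u < Suc 1}" using level_le by (fastforce simp: less_Suc_eq_le)
  then have "card V = card {u \<in> V. lev u < 1} + card (level V lev 1)"
    using card_lower_Suc[OF finite_V, of lev 1] by simp
  then show ?thesis using card_level_0 assms by (simp add: level_def)
qed

text \<open>The layers up to \<open>j\<close> hold at least \<open>1 + \<kappa> * j\<close>
  vertices, all of them two or more below a vertex on layer \<open>j + 2\<close>. The difference
  \<kappa>(j + 2) - (1 + \<kappa>j) = 2\<kappa> - 1 does not depend on j.\<close>

lemma weight_le:
  assumes "w \<in> V"
  shows "int \<kappa> * int (lev w) - int (card {u \<in> V. lev u + 2 \<le> lev w})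
    \<le> (if lev w = 0 then 0 else if lev w = 1 then int \<kappa> else 2 * int \<kappa> - 1)"
proof (cases "lev w \<le> 1")
  case True
  then show ?thesis by (auto simp: le_Suc_eq)
next
  case False
  then obtain j where j: "lev w = Suc (Suc j)" by (metis One_nat_def le_SucI not0_implies_Suc order.refl)
  then have "1 + \<kappa> * j \<le> card {u \<in> V. lev u + 2 \<le> lev w}"
    using card_lower[of j] level_le[OF assms] by (simp add: less_Suc_eq_le)
  then have "int (1 + \<kappa> * j) \<le> int (card {u \<in> V. lev u + 2 \<le> lev w})"
    by (simp only: of_nat_le_iff)
  then show ?thesis using j by (simp add: algebra_simps)
qed

lemma sum_lev_close_pairs_le:
  assumes "\<kappa> < card V"
  shows "2 * int \<kappa> * (\<Sum>w\<in>V. int (lev w)) + int (card (close_pairs V lev)) \<le> size_const \<kappa> (card V)"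
proof -
  have "(\<Sum>w\<in>V. int \<kappa> * int (lev w) - int (card {u \<in> V. lev u + 2 \<le> lev w}))
      \<le> (\<Sum>w\<in>V. if lev w = 0 then 0 else if lev w = 1 then int \<kappa> else 2 * int \<kappa> - 1)"
    by (intro sum_mono weight_le)
  also have "\<dots> = (2 * int \<kappa> - 1) * int (card V) - (2 * int \<kappa> - 1)
      - (int \<kappa> - 1) * int (card (level V lev 1))"
    using sum_level_weights[OF finite_V, of lev "int \<kappa>" "2 * int \<kappa> - 1"] card_level_0
    by simp
  \<comment> \<open>A vertex on layer 1 is allotted \<open>\<kappa> - 1\<close> less than one on a
    higher layer, so a lower bound on the size of layer 1 is needed.\<close>
  also have "\<dots> \<le> (2 * int \<kappa> - 1) * int (card V) - (2 * int \<kappa> - 1) - (int \<kappa> - 1) * int \<kappa>"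
    using card_level_1[OF assms] \<kappa>_pos by (simp add: mult_left_mono)
  finally show ?thesis
    unfolding sum_lev_close_pairs[OF finite_V] by (simp add: size_const_def algebra_simps)
qed

text \<open>A bound from the order alone, attained by a root, \<open>L\<close> layers of size
  \<kappa> and \<open>b\<close> vertices on layer \<open>L + 1\<close>. It settles the case in which
  the path-complete minimiser admits no further raising of a vertex.\<close>

lemma sum_lev_le:
  assumes n: "card V = 1 + \<kappa> * L + b" and b: "b \<le> \<kappa>"
  shows "2 * (\<Sum>w\<in>V. lev w) \<le> \<kappa> * L * (L + 1) + 2 * (L + 1) * b"
proof -
  \<comment> \<open>If \<open>j < d\<close>, the layers 0 to \<open>j\<close> use up at least
    \<open>1 + \<kappa> * j\<close> vertices; otherwise nothing lies above layer
    \<open>j\<close>.\<close>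
  have tail: "card {w \<in> V. j < lev w} \<le> \<kappa> * (L - j) + b" if "j \<le> L" for j
  proof (cases "j < d")
    case True
    have "card V = card {u \<in> V. lev u < Suc j} + card {w \<in> V. j < lev w}"
      by (subst card_Un_disjoint[symmetric]) (auto simp: finite_V intro!: arg_cong[of _ _ card])
    then have "card {w \<in> V. j < lev w} + \<kappa> * j \<le> \<kappa> * L + b"
      using card_lower[of j] True n by simp
    then show ?thesis using that by (simp add: diff_mult_distrib2)
  next
    case False
    then have "{w \<in> V. j < lev w} = {}" using level_le by fastforce
    then show ?thesis by (simp only: card.empty le0)
  qed
  \<comment> \<open>Otherwise layers 1 to \<open>L + 1\<close> would hold at least \<kappa>(L + 1)
    \<ge> \<kappa>L + b vertices, leaving none for layer \<open>d\<close>.\<close>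
  have top: "d \<le> Suc L"
  proof (rule ccontr)
    assume *: "\<not> d \<le> Suc L"
    then have d: "Suc (d - 1) = d" by simp
    have "{u \<in> V. lev u < d} \<subset> V" using level_top by (force simp: level_def)
    then have "card {u \<in> V. lev u < d} < card V" by (intro psubset_card_mono finite_V)
    then have "\<kappa> * (d - 1) < \<kappa> * L + b"
      using card_lower[of "d - 1"] d n by simp
    moreover have "\<kappa> * Suc L \<le> \<kappa> * (d - 1)"
      using * by (intro mult_le_mono2) simp
    ultimately show False using b by simp
  qed
  \<comment> \<open>Each level is the number of thresholds \<open>j\<close> below it; by
    \<open>top\<close> the thresholds up to \<open>L\<close> suffice.\<close>
  have "(\<Sum>w\<in>V. lev w) = (\<Sum>w\<in>V. \<Sum>j<Suc L. of_bool (j < lev w))"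
  proof (rule sum.cong)
    fix w assume "w \<in> V"
    then have "lev w \<le> Suc L" using level_le top le_trans by blast
    then have "{..<Suc L} \<inter> {j. j < lev w} = {..<lev w}" by auto
    then show "lev w = (\<Sum>j<Suc L. of_bool (j < lev w))"
      by (simp del: sum.lessThan_Suc)
  qed simp
  also have "\<dots> = (\<Sum>j<Suc L. card {w \<in> V. j < lev w})"
    by (subst sum.swap) (simp add: finite_V Int_def)
  also have "\<dots> \<le> (\<Sum>j<Suc L. \<kappa> * (L - j) + b)"
    by (intro sum_mono tail) simp
  also have "\<dots> = \<kappa> * (\<Sum>j<Suc L. L - j) + (L + 1) * b"
    by (simp add: sum.distrib sum_distrib_left)
  also have "(\<Sum>j<Suc L. L - j) = (\<Sum>j<Suc L. j)"
    by (rule sum.reindex_bij_witness[of _ "\<lambda>j. L - j" "\<lambda>j. L - j"]) auto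
  finally have "2 * (\<Sum>w\<in>V. lev w) \<le> 2 * (\<kappa> * (\<Sum>j<Suc L. j) + (L + 1) * b)" by (rule mult_le_mono2)
  also have "\<dots> = \<kappa> * (2 * (\<Sum>j<Suc L. j)) + 2 * (L + 1) * b"
    by (simp add: algebra_simps)
  also have "2 * (\<Sum>j<Suc L. j) = L * (L + 1)"
    by (induction L) auto
  finally show ?thesis by (simp only: mult.assoc)
qed

end

section \<open>Distance layers of balanced digraphs\<close>

context wf_digraph begin

text \<open>\<open>path_dist\<close> minimises over paths without repeated vertices; cutting the
  cycles out of a walk does not lengthen it.\<close>

lemma path_dist_le_awalk:
  assumes "awalk u p v"
  shows "path_dist G u v \<le> length p"
proof -
  have "\<exists>q. apath u q v \<and> length q \<le> length p"
    using assms
  proof (induct rule: awalk_to_apath_induct)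
    case (path p)
    then show ?case by (auto simp: apath_def)
  next
    case (decomp p q r s)
    then have "p = q @ r @ s" by (elim awalk_cyc_decompE)
    with decomp(4) show ?case by fastforce
  qed
  then obtain q where "apath u q v" "length q \<le> length p" by blast
  then have "path_dist G u v \<le> length q"
    unfolding path_dist_def by (intro Least_le) blast
  with \<open>length q \<le> length p\<close> show ?thesis by simp
qed

lemma path_dist_apath:
  assumes "u \<rightarrow>\<^sup>* v"
  obtains p where "apath u p v" "length p = path_dist G u v"
proof -
  have "\<exists>k p. apath u p v \<and> length p = k" using assms by (simp add: reachable_apath)
  then have "\<exists>p. apath u p v \<and> length p = path_dist G u v"
    unfolding path_dist_def by (rule LeastI_ex)
  with that show ?thesis by blast
qed

lemma path_dist_eq_0_iff:
  assumes "u \<rightarrow>\<^sup>* v"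
  shows "path_dist G u v = 0 \<longleftrightarrow> u = v"
proof
  assume "path_dist G u v = 0"
  with path_dist_apath[OF assms] show "u = v" by (auto simp: apath_Nil_iff)
next
  assume "u = v"
  with assms have "awalk u [] v" by (simp add: awalk_Nil_iff reachable_in_verts)
  from path_dist_le_awalk[OF this] show "path_dist G u v = 0" by simp
qed

lemma path_dist_head_le:
  assumes "e \<in> arcs G" "u \<rightarrow>\<^sup>* tail G e"
  shows "path_dist G u (head G e) \<le> path_dist G u (tail G e) + 1"
proof -
  obtain p where p: "apath u p (tail G e)" "length p = path_dist G u (tail G e)"
    using path_dist_apath[OF assms(2)] .
  then have "awalk u (p @ [e]) (head G e)"
    using assms(1) by (auto simp: apath_def awalk_simps)
  from path_dist_le_awalk[OF this] p(2) show ?thesis by simp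
qed

text \<open>Applied to the level function of a path-complete graph, this bounds its distances from
  below without computing them.\<close>

lemma potential_le_path_dist:
  assumes step: "\<And>e. e \<in> arcs G \<Longrightarrow> lev (head G e) \<le> lev (tail G e) + 1"
    and "u \<rightarrow>\<^sup>* v"
  shows "lev v \<le> lev u + path_dist G u v"
proof -
  obtain p where p: "apath u p v" "length p = path_dist G u v"
    using path_dist_apath[OF assms(2)] .
  from p(1) have "awalk u p v" by (simp add: apath_def)
  then have "lev v \<le> lev u + length p"
  proof (induction p arbitrary: u)
    case (Cons e p)
    then have "lev v \<le> lev (head G e) + length p" "e \<in> arcs G" "tail G e = u"
      by (auto simp: awalk_Cons_iff)
    with step[of e] show ?case by simp
  qed (simp add: awalk_Nil_iff)
  with p(2) show ?thesis by simp
qed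

end

section \<open>Vertex-connectivity and separating layers\<close>

lemma vertex_connectivity_le:
  assumes "S \<subseteq> verts D" "\<not> strongly_connected (D \<restriction> (verts D - S))"
  shows "vertex_connectivity D \<le> card S"
  unfolding vertex_connectivity_def using assms by (intro Least_le) blast

text \<open>Deleting all vertices leaves the empty digraph, which is not strongly connected. So the
  minimum is attained by some separating set, and that set cannot have fewer than \<kappa>
  vertices.\<close>

lemma k_connectedI:
  assumes "\<And>S. S \<subseteq> verts D \<Longrightarrow> card S < \<kappa> \<Longrightarrow> strongly_connected (D \<restriction> (verts D - S))"
  shows "k_connected \<kappa> D"
proof -
  have "\<not> strongly_connected (D \<restriction> (verts D - verts D))"
    by (simp add: strongly_connected_def induce_subgraph_def)
  then have "\<exists>k S. S \<subseteq> verts D \<and> card S = k \<and> \<not> strongly_connected (D \<restriction> (verts D - S))"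
    by blast
  then have "\<exists>S \<subseteq> verts D. card S = vertex_connectivity D
      \<and> \<not> strongly_connected (D \<restriction> (verts D - S))"
    unfolding vertex_connectivity_def by (rule LeastI_ex)
  then show ?thesis
    using assms unfolding k_connected_def by (metis not_le)
qed

text \<open>Arcs climb by at most one level, so once layer \<open>i\<close> is removed nothing above
  it can be reached from below it.\<close>

lemma (in wf_digraph) card_separating_level:
  assumes step: "\<And>e. e \<in> arcs G \<Longrightarrow> lev (head G e) \<le> lev (tail G e) + 1"
    and u: "u \<in> verts G" "lev u < i" and w: "w \<in> verts G" "i < lev w"
    and "k_connected \<kappa> G"
  shows "\<kappa> \<le> card (level (verts G) lev i)"
proof -
  let ?H = "G \<restriction> (verts G - level (verts G) lev i)"
  interpret H: wf_digraph ?H by (rule wellformed_induce_subgraph)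
  have "\<not> strongly_connected ?H"
  proof
    assume "strongly_connected ?H"
    moreover have "u \<in> verts ?H" "w \<in> verts ?H"
      using u w by (auto simp: level_def)
    ultimately have "u \<rightarrow>\<^sup>*\<^bsub>?H\<^esub> w"
      unfolding strongly_connected_def by blast
    then have "lev w < i"
    proof (induction rule: H.reachable_induct)
      case base
      then show ?case using u by simp
    next
      case (step x y)
      from step(2) obtain e where e: "e \<in> arcs ?H" "tail ?H e = x" "head ?H e = y" by blast
      then have "lev y \<le> lev x + 1" using assms(1)[of e] by auto
      moreover have "lev y \<noteq> i" using e by (auto simp: level_def)
      ultimately show ?case using step(3) by simp
    qed
    with w show False by simp
  qed
  then have "vertex_connectivity G \<le> card (level (verts G) lev i)"
    by (intro vertex_connectivity_le) (auto simp: level_def)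
  with assms(6) show ?thesis by (simp add: k_connected_def)
qed

text \<open>Every layer strictly between the first and the last separates \<open>v\<close> from a
  farthest vertex.\<close>

lemma (in fin_digraph) layering_path_dist:
  assumes "strongly_connected G" "k_connected \<kappa> G" "1 \<le> \<kappa>" "v \<in> verts G"
  shows "layering (verts G) (path_dist G v) \<kappa> (Max (path_dist G v ` verts G))"
proof
  have reach: "v \<rightarrow>\<^sup>* w" if "w \<in> verts G" for w
    using assms that by (auto simp: strongly_connected_def)
  have step: "path_dist G v (head G e) \<le> path_dist G v (tail G e) + 1" if "e \<in> arcs G" for e
    using that by (intro path_dist_head_le reach) auto
  show "finite (verts G)" by simp
  show "1 \<le> \<kappa>" by fact
  have "level (verts G) (path_dist G v) 0 = {v}"
    using assms(4) path_dist_eq_0_iff[OF reach] by (auto simp: level_def)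
  then show "card (level (verts G) (path_dist G v) 0) = 1" by simp
  have "Max (path_dist G v ` verts G) \<in> path_dist G v ` verts G"
    using assms(4) by (intro Max_in) auto
  then obtain w where w: "w \<in> verts G" "path_dist G v w = Max (path_dist G v ` verts G)" by force
  then show "level (verts G) (path_dist G v) (Max (path_dist G v ` verts G)) \<noteq> {}"
    by (auto simp: level_def)
  show "path_dist G v x \<le> Max (path_dist G v ` verts G)" if "x \<in> verts G" for x
    using that by (intro Max_ge) auto
  show "\<kappa> \<le> card (level (verts G) (path_dist G v) i)"
    if "0 < i" "i < Max (path_dist G v ` verts G)" for i
    using step assms(4) path_dist_eq_0_iff[OF reach[OF assms(4)]] that w assms(2)
    by (intro card_separating_level[of _ v i w]) auto
qed

text \<open>Downward arcs may skip levels and need not be close pairs. Balance bounds their number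
  by that of the upward arcs, so the mirror images of upward pairs can pay for them.\<close>

lemma (in digraph) card_arcs_le_close_pairs:
  assumes balanced: "\<And>u. u \<in> verts G \<Longrightarrow> in_degree G u = out_degree G u"
    and step: "\<And>e. e \<in> arcs G \<Longrightarrow> lev (head G e) \<le> lev (tail G e) + 1"
  shows "card (arcs G) \<le> card (close_pairs (verts G) lev)"
proof -
  let ?V = "verts G"
  define Up where "Up = {e \<in> arcs G. lev (head G e) = lev (tail G e) + 1}"
  define Eq where "Eq = {e \<in> arcs G. lev (head G e) = lev (tail G e)}"
  define Dn where "Dn = {e \<in> arcs G. lev (head G e) < lev (tail G e)}"
  define U where "U = {(u, w) \<in> ?V \<times> ?V. lev w = lev u + 1}"
  define E where "E = {(u, w) \<in> ?V \<times> ?V. u \<noteq> w \<and> lev w = lev u}"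
  \<comment> \<open>Grouping the arcs by head, and below by tail, makes the total change of level
    along all arcs vanish.\<close>
  have "(\<Sum>e\<in>arcs G. int (lev (head G e))) = (\<Sum>w\<in>?V. int (in_degree G w) * int (lev w))"
    by (subst sum.group[where g = "head G" and T = ?V, symmetric])
      (auto simp: in_degree_def in_arcs_def)
  also have "\<dots> = (\<Sum>w\<in>?V. int (out_degree G w) * int (lev w))"
    using balanced by simp
  also have "\<dots> = (\<Sum>e\<in>arcs G. int (lev (tail G e)))"
    by (rule sym, subst sum.group[where g = "tail G" and T = ?V, symmetric])
      (auto simp: out_degree_def out_arcs_def)
  finally have "0 = (\<Sum>e\<in>arcs G. int (lev (head G e)) - int (lev (tail G e)))"
    by (simp add: sum_subtractf)
  \<comment> \<open>An upward arc contributes exactly 1, a downward arc at most -1.\<close>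
  also have "\<dots> \<le> (\<Sum>e\<in>arcs G. of_bool (e \<in> Up) - of_bool (e \<in> Dn))"
  proof (rule sum_mono)
    fix e assume "e \<in> arcs G"
    with step[of e] show "int (lev (head G e)) - int (lev (tail G e)) \<le> of_bool (e \<in> Up) - of_bool (e \<in> Dn)"
      by (auto simp: Up_def Dn_def of_bool_def)
  qed
  also have "\<dots> = int (card Up) - int (card Dn)"
  proof -
    have "arcs G \<inter> Up = Up" "arcs G \<inter> Dn = Dn" by (auto simp: Up_def Dn_def)
    then show ?thesis by (simp add: sum_subtractf)
  qed
  finally have DnUp: "card Dn \<le> card Up" by simp
  have finV: "finite (?V \<times> ?V)" by simp
  have finU: "finite U" and finE: "finite E"
    by (auto intro: finite_subset[OF _ finV] simp: U_def E_def)
  have inj: "inj_on (arc_to_ends G) X" if "X \<subseteq> arcs G" for X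
    using inj_on_arc_to_ends that by (rule inj_on_subset)
  have "card Up \<le> card U"
    by (rule card_inj_on_le[OF inj _ finU]) (auto simp: Up_def U_def arc_to_ends_def)
  moreover have "card Eq \<le> card E"
    by (rule card_inj_on_le[OF inj _ finE])
      (auto simp: Eq_def E_def arc_to_ends_def dest: no_loops)
  moreover have "card (arcs G) = card Up + card Eq + card Dn"
  proof -
    have "arcs G = Up \<union> Eq \<union> Dn"
      using step by (fastforce simp: Up_def Eq_def Dn_def)
    moreover have "finite Up" "finite Eq" "finite Dn" by (auto simp: Up_def Eq_def Dn_def)
    moreover have "Up \<inter> Eq = {}" "(Up \<union> Eq) \<inter> Dn = {}" by (auto simp: Up_def Eq_def Dn_def)
    ultimately show ?thesis by (simp add: card_Un_disjoint)
  qed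
  moreover have "card (close_pairs ?V lev) = card E + card U + card U"
  proof -
    have "close_pairs ?V lev = E \<union> U \<union> prod.swap ` U"
      by (force simp: close_pairs_def E_def U_def image_iff)
    moreover have "E \<inter> U = {}" "(E \<union> U) \<inter> prod.swap ` U = {}" by (auto simp: U_def E_def)
    moreover have "card (prod.swap ` U) = card U"
      by (intro card_image) (auto simp: inj_on_def)
    ultimately show ?thesis using finU finE by (simp add: card_Un_disjoint)
  qed
  ultimately show ?thesis using DnUp by linarith
qed

lemma eulerian_digraph_balanced:
  assumes "eulerian_digraph D" "u \<in> verts D"
  shows "in_degree D u = out_degree D u"
proof -
  interpret digraph D using assms by (simp add: eulerian_digraph_def)
  show ?thesis using assms closed_euler by (auto simp: eulerian_digraph_def)
qed

text \<open>The first bound trades distance against size. The second uses only the order and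
  \<kappa>-connectivity, and takes over where no exchange in the path-complete graph is
  possible.\<close>

lemma admissible_sum_path_dist:
  assumes "admissible \<kappa> n m D" "1 \<le> \<kappa>" "\<kappa> < n" "v \<in> verts D"
  defines "T \<equiv> (\<Sum>w\<in>verts D. path_dist D v w)"
  shows "2 * int \<kappa> * int T + 2 * int m \<le> size_const \<kappa> n"
    and "\<And>L b. n = 1 + \<kappa> * L + b \<Longrightarrow> b \<le> \<kappa> \<Longrightarrow> 2 * T \<le> \<kappa> * L * (L + 1) + 2 * (L + 1) * b"
proof -
  have E: "eulerian_digraph D" and k: "k_connected \<kappa> D" and n: "card (verts D) = n"
    and m: "2 * m \<le> card (arcs D)"
    using assms by (auto simp: admissible_def)
  interpret digraph D using E by (simp add: eulerian_digraph_def)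
  have sc: "strongly_connected D" using E by (simp add: eulerian_digraph_def)
  interpret layering "verts D" "path_dist D v" \<kappa> "Max (path_dist D v ` verts D)"
    using sc k assms(2,4) by (rule layering_path_dist)
  have "card (arcs D) \<le> card (close_pairs (verts D) (path_dist D v))"
    using sc assms(4)
    by (intro card_arcs_le_close_pairs eulerian_digraph_balanced[OF E] path_dist_head_le)
      (auto simp: strongly_connected_def)
  then show "2 * int \<kappa> * int T + 2 * int m \<le> size_const \<kappa> n"
    using sum_lev_close_pairs_le n m assms(3) by (simp add: T_def)
  show "2 * T \<le> \<kappa> * L * (L + 1) + 2 * (L + 1) * b" if "n = 1 + \<kappa> * L + b" "b \<le> \<kappa>" for L b
    unfolding T_def using that n by (intro sum_lev_le) auto
qed

section \<open>Layered graphs\<close>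

text \<open>Describing path-complete graphs by a level function puts them in the same setting as
  distance layers.\<close>

definition level_graph :: "'v set \<Rightarrow> ('v \<Rightarrow> nat) \<Rightarrow> 'v ugraph" where
  "level_graph V lev =
     \<lparr> uverts = V, uedges = (\<lambda>(u, w). {u, w}) ` close_pairs V lev \<rparr>"

definition has_level_sizes :: "nat list \<Rightarrow> 'v set \<Rightarrow> ('v \<Rightarrow> nat) \<Rightarrow> bool" where
  "has_level_sizes ns V lev \<longleftrightarrow> finite V \<and> (\<forall>w\<in>V. lev w < length ns) \<and>
     (\<forall>i<length ns. card (level V lev i) = ns ! i)"

text \<open>Edges inside a summand join equal levels, edges between neighbouring summands join
  consecutive ones, and these are all the close pairs.\<close>

lemma sequential_sum_eq_level_graph:
  assumes lev: "\<And>w. w \<in> V \<Longrightarrow> lev w < length Gs"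
    and verts: "\<And>i. i < length Gs \<Longrightarrow> uverts (Gs ! i) = level V lev i"
    and edges: "\<And>i. i < length Gs \<Longrightarrow> uedges (Gs ! i) = {e. e \<subseteq> level V lev i \<and> card e = 2}"
  shows "sequential_sum Gs = level_graph V lev"
proof -
  have "(\<Union>G\<in>set Gs. uverts G) = (\<Union>i<length Gs. uverts (Gs ! i))"
    by (auto simp: set_conv_nth)
  also have "\<dots> = V" using lev verts by (fastforce simp: level_def)
  finally have V: "(\<Union>G\<in>set Gs. uverts G) = V" .
  have inner: "(\<Union>G\<in>set Gs. uedges G) = (\<Union>i<length Gs. {e. e \<subseteq> level V lev i \<and> card e = 2})"
    using edges by (fastforce simp: set_conv_nth)
  let ?E = "(\<Union>G\<in>set Gs. uedges G) \<union>
    {{u, v} | i u v. Suc i < length Gs \<and> u \<in> uverts (Gs ! i) \<and> v \<in> uverts (Gs ! Suc i)}"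
  have "?E = (\<lambda>(u, w). {u, w}) ` close_pairs V lev"
  proof (intro equalityI subsetI)
    fix e assume "e \<in> ?E"
    then consider i where "i < length Gs" "e \<subseteq> level V lev i" "card e = 2"
      | i u v where "Suc i < length Gs" "e = {u, v}" "u \<in> level V lev i" "v \<in> level V lev (Suc i)"
      using verts unfolding inner by auto
    then show "e \<in> (\<lambda>(u, w). {u, w}) ` close_pairs V lev"
    proof cases
      case 1
      then obtain u v where "e = {u, v}" "u \<noteq> v" by (auto simp: card_2_iff)
      with 1 have "(u, v) \<in> close_pairs V lev" by (auto simp: close_pairs_def level_def)
      with \<open>e = {u, v}\<close> show ?thesis by force
    next
      case 2
      then have "(u, v) \<in> close_pairs V lev" by (auto simp: close_pairs_def level_def)
      with \<open>e = {u, v}\<close> show ?thesis by force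
    qed
  next
    fix e assume "e \<in> (\<lambda>(u, w). {u, w}) ` close_pairs V lev"
    then obtain u w where e: "e = {u, w}" and uw: "(u, w) \<in> close_pairs V lev" by auto
    then have mem: "u \<in> V" "w \<in> V" "u \<noteq> w" by (auto simp: close_pairs_def)
    from uw consider "lev u = lev w" | "lev w = Suc (lev u)" | "lev u = Suc (lev w)"
      by (auto simp: close_pairs_def le_Suc_eq)
    then show "e \<in> ?E"
    proof cases
      case 1
      then have "e \<subseteq> level V lev (lev w)" "card e = 2" using e mem by (auto simp: level_def)
      then show ?thesis unfolding inner using lev[OF mem(2)] by blast
    next
      case 2
      then have "Suc (lev u) < length Gs" using lev[OF mem(2)] by simp
      moreover have "u \<in> uverts (Gs ! lev u)" "w \<in> uverts (Gs ! Suc (lev u))"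
        using 2 mem \<open>Suc (lev u) < length Gs\<close> verts by (auto simp: level_def)
      ultimately show ?thesis using e by blast
    next
      case 3
      then have "Suc (lev w) < length Gs" using lev[OF mem(1)] by simp
      moreover have "w \<in> uverts (Gs ! lev w)" "u \<in> uverts (Gs ! Suc (lev w))"
        using 3 mem \<open>Suc (lev w) < length Gs\<close> verts by (auto simp: level_def)
      moreover have "e = {w, u}" using e by auto
      ultimately show ?thesis by blast
    qed
  qed
  then show ?thesis
    unfolding sequential_sum_def level_graph_def using V by simp
qed

text \<open>Disjointness makes the index of the summand containing a vertex a well-defined level;
  conversely, the complete graphs on the layers serve as summands.\<close>

lemma sequential_sum_complete_iff:
  "(\<exists>Gs. list_all2 complete_graph ns Gs \<and> pairwise_disjoint Gs \<and> G = sequential_sum Gs) \<longleftrightarrow>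
   (\<exists>lev. has_level_sizes ns (uverts G) lev \<and> G = level_graph (uverts G) lev)"
proof
  assume "\<exists>Gs. list_all2 complete_graph ns Gs \<and> pairwise_disjoint Gs \<and> G = sequential_sum Gs"
  then obtain Gs where Gs: "list_all2 complete_graph ns Gs" "pairwise_disjoint Gs"
    and G: "G = sequential_sum Gs" by blast
  have len: "length ns = length Gs" using Gs(1) by (rule list_all2_lengthD)
  have comp: "complete_graph (ns ! i) (Gs ! i)" if "i < length Gs" for i
    using Gs(1) that by (simp add: list_all2_conv_all_nth)
  define V where "V = (\<Union>i<length Gs. uverts (Gs ! i))"
  have V: "V = uverts G"
    unfolding V_def G sequential_sum_def by (auto simp: set_conv_nth)
  define lev where "lev u = (LEAST i. i < length Gs \<and> u \<in> uverts (Gs ! i))" for u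
  have disj: "i = j" if "i < length Gs" "j < length Gs" "u \<in> uverts (Gs ! i)" "u \<in> uverts (Gs ! j)"
    for i j u
    using Gs(2) that unfolding pairwise_disjoint_def by (metis disjoint_iff nat_neq_iff)
  have lev_eq: "lev u = i" if "i < length Gs" "u \<in> uverts (Gs ! i)" for u i
    unfolding lev_def by (rule Least_equality) (use that disj in auto)
  have lev: "lev u < length Gs" if "u \<in> V" for u
    using that lev_eq by (auto simp: V_def)
  have verts: "uverts (Gs ! i) = level V lev i" if "i < length Gs" for i
    using that lev_eq by (fastforce simp: level_def V_def)
  have "sequential_sum Gs = level_graph V lev"
    using lev verts comp by (intro sequential_sum_eq_level_graph) (auto simp: complete_graph_def)
  moreover have "finite V"
    using comp by (auto simp: V_def complete_graph_def)
  then have "has_level_sizes ns V lev"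
    using lev len comp verts by (auto simp: has_level_sizes_def complete_graph_def)
  ultimately show "\<exists>lev. has_level_sizes ns (uverts G) lev \<and> G = level_graph (uverts G) lev"
    using V G by blast
next
  assume "\<exists>lev. has_level_sizes ns (uverts G) lev \<and> G = level_graph (uverts G) lev"
  then obtain lev where lev: "has_level_sizes ns (uverts G) lev"
    and G: "G = level_graph (uverts G) lev" by blast
  define H where "H i = \<lparr> uverts = level (uverts G) lev i,
    uedges = {e. e \<subseteq> level (uverts G) lev i \<and> card e = 2} \<rparr>" for i
  define Gs where "Gs = map H [0..<length ns]"
  have len: "length Gs = length ns" by (simp add: Gs_def)
  have nth: "Gs ! i = H i" if "i < length ns" for i
    using that by (simp add: Gs_def)
  have "list_all2 complete_graph ns Gs"
    using lev len nth by (auto simp: list_all2_conv_all_nth complete_graph_def H_def has_level_sizes_def)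
  moreover have "pairwise_disjoint Gs"
    using len nth by (auto simp: pairwise_disjoint_def H_def level_def)
  moreover have "sequential_sum Gs = level_graph (uverts G) lev"
    using lev len nth by (intro sequential_sum_eq_level_graph) (auto simp: H_def has_level_sizes_def)
  ultimately show "\<exists>Gs. list_all2 complete_graph ns Gs \<and> pairwise_disjoint Gs \<and> G = sequential_sum Gs"
    using G by metis
qed

section \<open>Layered graphs as bidirected digraphs\<close>

lemma close_pairs_sym: "(u, w) \<in> close_pairs V lev \<longleftrightarrow> (w, u) \<in> close_pairs V lev"
  by (auto simp: close_pairs_def)

lemma finite_close_pairs: "finite V \<Longrightarrow> finite (close_pairs V lev)"
  by (rule finite_subset[of _ "V \<times> V"]) (auto simp: close_pairs_def)

lemma usize_level_graph:
  assumes "finite V"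
  shows "2 * usize (level_graph V lev) = card (close_pairs V lev)"
proof -
  let ?C = "close_pairs V lev" and ?f = "\<lambda>(u, w). {u, w}"
  have "card {p \<in> ?C. ?f p = e} = 2" if "e \<in> ?f ` ?C" for e
  proof -
    from that obtain u w where "e = {u, w}" "(u, w) \<in> ?C" by auto
    moreover from this have "u \<noteq> w" by (auto simp: close_pairs_def)
    moreover have "{p \<in> ?C. ?f p = e} = {(u, w), (w, u)}"
      using calculation close_pairs_sym[of u w V lev] by (auto simp: doubleton_eq_iff)
    ultimately show ?thesis by simp
  qed
  then have "(\<Sum>e\<in>?f ` ?C. card {p \<in> ?C. ?f p = e}) = 2 * usize (level_graph V lev)"
    by (simp add: usize_def level_graph_def)
  moreover have "(\<Sum>e\<in>?f ` ?C. card {p \<in> ?C. ?f p = e}) = card ?C"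
    unfolding card_eq_sum by (rule sum.group) (auto simp: finite_close_pairs assms)
  ultimately show ?thesis by simp
qed

lemma bidirected_level_graph:
  "bidirected (level_graph V lev) = \<lparr> verts = V, arcs = close_pairs V lev, tail = fst, head = snd \<rparr>"
proof -
  have "{u, v} \<in> (\<lambda>(u, w). {u, w}) ` close_pairs V lev \<longleftrightarrow> (u, v) \<in> close_pairs V lev" for u v
    using close_pairs_sym[of u v V lev] by (force simp: doubleton_eq_iff)
  then show ?thesis by (simp add: bidirected_def level_graph_def)
qed

lemma digraph_bidirected_level_graph:
  assumes "finite V"
  shows "digraph (bidirected (level_graph V lev))"
  unfolding bidirected_level_graph
  by unfold_locales
    (use assms finite_close_pairs[OF assms, of lev] in \<open>auto simp: close_pairs_def arc_to_ends_def\<close>)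

text \<open>Every intermediate layer keeps a vertex outside \<open>S\<close>, so one can climb layer
  by layer; symmetry gives the way down.\<close>

lemma strongly_connected_delete_level_graph:
  assumes "finite V"
    and d: "\<And>w. w \<in> V \<Longrightarrow> lev w \<le> d"
    and level: "\<And>i. 0 < i \<Longrightarrow> i < d \<Longrightarrow> card S < card (level V lev i)"
    and "S \<subseteq> V" "card S < card V"
  shows "strongly_connected (bidirected (level_graph V lev) \<restriction> (V - S))"
proof -
  let ?D = "bidirected (level_graph V lev)"
  let ?H = "?D \<restriction> (V - S)"
  interpret D: digraph ?D using assms(1) by (rule digraph_bidirected_level_graph)
  interpret H: wf_digraph ?H by (rule D.wellformed_induce_subgraph)
  have adj: "u \<rightarrow>\<^bsub>?H\<^esub> w" if "(u, w) \<in> close_pairs V lev" "u \<notin> S" "w \<notin> S" for u w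
    using that by (intro H.dominatesI[of "(u, w)"])
      (auto simp: bidirected_level_graph arc_to_ends_def close_pairs_def)
  have "symmetric ?H"
    unfolding symmetric_conv
    by (auto simp: bidirected_level_graph close_pairs_def)
  note sym = symmetric_reachable[OF this]
  have up: "u \<rightarrow>\<^sup>*\<^bsub>?H\<^esub> w" if "u \<in> V - S" "w \<in> V - S" "lev u \<le> lev w" for u w
    using that
  proof (induction "lev w - lev u" arbitrary: u rule: less_induct)
    case less
    consider "u = w" | "u \<noteq> w" "lev w \<le> lev u + 1" | "lev u + 1 < lev w" by linarith
    then show ?case
    proof cases
      case 1
      then show ?thesis using less.prems by auto
    next
      case 2
      then show ?thesis using less.prems adj by (auto simp: close_pairs_def)
    next
      case 3
      \<comment> \<open>The next layer lies strictly below that of \<open>w\<close>, hence strictly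
        between 0 and \<open>d\<close>.\<close>
      then have "card S < card (level V lev (lev u + 1))"
        using level[of "lev u + 1"] d[of w] less.prems by auto
      moreover have "finite S" using assms(1,4) finite_subset by blast
      ultimately have "\<not> level V lev (lev u + 1) \<subseteq> S"
        by (meson card_mono not_le)
      then obtain c where c: "c \<in> V - S" "lev c = lev u + 1" by (auto simp: level_def)
      then have "u \<rightarrow>\<^bsub>?H\<^esub> c"
        using less.prems by (intro adj) (auto simp: close_pairs_def)
      moreover have "c \<rightarrow>\<^sup>*\<^bsub>?H\<^esub> w"
        using less.hyps[of c] less.prems c 3 by auto
      ultimately show ?thesis by (rule H.adj_reachable_trans)
    qed
  qed
  have "u \<rightarrow>\<^sup>*\<^bsub>?H\<^esub> w" if "u \<in> V - S" "w \<in> V - S" for u w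
    using up[of u w] up[of w u] sym that by (meson nat_le_linear)
  moreover have "V - S \<noteq> {}" using assms by auto
  ultimately show ?thesis
    by (simp add: strongly_connected_def)
qed

lemma (in wf_digraph) strongly_connected_imp_connected:
  "strongly_connected G \<Longrightarrow> connected G"
  by (auto simp: connected_def strongly_connected_def reachable_mk_symmetricI)

text \<open>Makes the bidirected path-complete graph itself a competitor, which yields sharpness.
  Reversing arcs shows that it is balanced, and with connectedness this gives an Eulerian
  circuit.\<close>

lemma (in layering) admissible_level_graph:
  assumes "\<kappa> \<le> card V" and "m \<le> usize (level_graph V lev)"
  shows "admissible \<kappa> (card V) m (bidirected (level_graph V lev))"
proof -
  let ?D = "bidirected (level_graph V lev)"
  interpret D: digraph ?D using finite_V by (rule digraph_bidirected_level_graph)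
  have vD [simp]: "verts ?D = V" by (simp add: bidirected_level_graph)
  have del: "strongly_connected (?D \<restriction> (V - S))" if "S \<subseteq> V" "card S < \<kappa>" for S
    using that card_level assms(1) level_le
    by (intro strongly_connected_delete_level_graph[where d = d] finite_V) (auto intro: less_le_trans)
  then have "k_connected \<kappa> ?D" by (intro k_connectedI) auto
  moreover have "?D \<restriction> V = ?D"
    by (auto simp: induce_subgraph_def bidirected_level_graph close_pairs_def)
  then have sc: "strongly_connected ?D"
    using del[of "{}"] \<kappa>_pos by auto
  moreover have "in_degree ?D u = out_degree ?D u" for u
  proof -
    have "prod.swap ` out_arcs ?D u = in_arcs ?D u"
      by (auto simp: in_arcs_def out_arcs_def bidirected_level_graph image_iff close_pairs_sym)
    moreover have "card (prod.swap ` out_arcs ?D u) = card (out_arcs ?D u)"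
      by (intro card_image) (auto simp: inj_on_def)
    ultimately show ?thesis by (simp add: in_degree_def out_degree_def)
  qed
  then have "\<exists>u p. D.euler_trail u p u"
    using D.closed_euler D.strongly_connected_imp_connected[OF sc] by blast
  moreover have "card (arcs ?D) = 2 * usize (level_graph V lev)"
    using usize_level_graph[OF finite_V, of lev] by (simp add: bidirected_level_graph)
  ultimately show ?thesis
    using assms(2) D.digraph_axioms
    by (simp add: admissible_def eulerian_digraph_def)
qed

section \<open>Path-complete graphs\<close>

text \<open>The parameters are those of \<open>K\<^sub>1 + [K\<^sub>\<kappa>]\<^sup>l + K\<^sub>a +
  K\<^sub>b\<close>, with the summands as layers 0 to \<open>l + 2\<close>.\<close>

locale path_complete_levels =
  fixes \<kappa> l a b :: nat and V :: "'v set" and lev :: "'v \<Rightarrow> nat"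
  assumes \<kappa>_pos: "1 \<le> \<kappa>" and l_pos: "1 \<le> l" and \<kappa>_le_a: "\<kappa> \<le> a" and b_pos: "1 \<le> b"
    and finite_V: "finite V"
    and level_le: "\<And>w. w \<in> V \<Longrightarrow> lev w \<le> l + 2"
    and card_level_0: "card (level V lev 0) = 1"
    and card_level_\<kappa>: "\<And>i. 0 < i \<Longrightarrow> i \<le> l \<Longrightarrow> card (level V lev i) = \<kappa>"
    and card_level_a: "card (level V lev (l + 1)) = a"
    and card_level_b: "card (level V lev (l + 2)) = b"

lemma path_complete_iff:
  assumes "1 \<le> \<kappa>"
  shows "path_complete \<kappa> G \<longleftrightarrow>
    (\<exists>l a b lev. path_complete_levels \<kappa> l a b (uverts G) lev \<and> G = level_graph (uverts G) lev)"
proof -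
  have nth: "([1] @ replicate l \<kappa> @ [a, b]) ! i
      = (if i = 0 then 1 else if i \<le> l then \<kappa> else if i = l + 1 then a else b)"
    if "i < l + 3" for l a b i :: nat
    using that by (cases i) (auto simp: nth_append less_Suc_eq)
  have len: "length ([1] @ replicate l \<kappa> @ [a, b]) = l + 3" for l a b by simp
  have sizes: "has_level_sizes ([1] @ replicate l \<kappa> @ [a, b]) V lev \<longleftrightarrow>
      finite V \<and> (\<forall>w\<in>V. lev w < l + 3) \<and> (\<forall>i<l + 3. card (level V lev i) =
        (if i = 0 then 1 else if i \<le> l then \<kappa> else if i = l + 1 then a else b))"
    for l a b and V :: "'a set" and lev
    unfolding has_level_sizes_def len by (simp only: nth cong: imp_cong conj_cong)
  have "has_level_sizes ([1] @ replicate l \<kappa> @ [a, b]) V lev \<and> 1 \<le> l \<and> 1 \<le> a \<and> 1 \<le> b \<and> \<kappa> \<le> a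
      \<longleftrightarrow> path_complete_levels \<kappa> l a b V lev" for l a b and V :: "'a set" and lev
    unfolding sizes
  proof
    assume "(finite V \<and> (\<forall>w\<in>V. lev w < l + 3) \<and> (\<forall>i<l + 3. card (level V lev i) =
        (if i = 0 then 1 else if i \<le> l then \<kappa> else if i = l + 1 then a else b)))
        \<and> 1 \<le> l \<and> 1 \<le> a \<and> 1 \<le> b \<and> \<kappa> \<le> a"
    with assms show "path_complete_levels \<kappa> l a b V lev"
      by unfold_locales (auto simp: less_Suc_eq_le numeral_eq_Suc)
  next
    assume "path_complete_levels \<kappa> l a b V lev"
    then interpret path_complete_levels \<kappa> l a b V lev .
    have "card (level V lev i) = (if i = 0 then 1 else if i \<le> l then \<kappa> else if i = l + 1 then a else b)"
      if i: "i < l + 3" for i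
    proof -
      consider "i = 0" | "0 < i" "i \<le> l" | "i = l + 1" | "i = l + 2" using i by linarith
      then show ?thesis
        using card_level_0 card_level_\<kappa> card_level_a card_level_b by cases auto
    qed
    moreover have "lev w < l + 3" if "w \<in> V" for w
      using level_le[OF that] by simp
    ultimately show "(finite V \<and> (\<forall>w\<in>V. lev w < l + 3) \<and> (\<forall>i<l + 3. card (level V lev i) =
        (if i = 0 then 1 else if i \<le> l then \<kappa> else if i = l + 1 then a else b)))
        \<and> 1 \<le> l \<and> 1 \<le> a \<and> 1 \<le> b \<and> \<kappa> \<le> a"
      using assms finite_V l_pos \<kappa>_le_a b_pos by (meson le_trans)
  qed
  then show ?thesis
    unfolding path_complete_def
    using sequential_sum_complete_iff[of _ G] by (metis (no_types, lifting))
qed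

context path_complete_levels
begin

text \<open>Layer \<open>l + 1\<close> is large enough because \<open>\<kappa> \<le> a\<close>;
  layer \<open>l + 2\<close> may be smaller, being the last.\<close>

sublocale layering V lev \<kappa> "l + 2"
proof
  show "\<kappa> \<le> card (level V lev i)" if "0 < i" "i < l + 2" for i
    using that card_level_\<kappa>[of i] card_level_a \<kappa>_le_a by (cases "i \<le> l") (auto simp: not_le less_Suc_eq)
  show "level V lev (l + 2) \<noteq> {}"
    using card_level_b b_pos by auto
qed (fact \<kappa>_pos finite_V level_le card_level_0)+

text \<open>A constant \<open>f\<close> yields the order, the identity yields the sum of the
  levels.\<close>

lemma sum_levels: "(\<Sum>w\<in>V. f (lev w)) = f 0 + \<kappa> * (\<Sum>i = 1..l. f i) + a * f (l + 1) + b * f (l + 2)"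
  for f :: "nat \<Rightarrow> nat"
proof -
  have split: "(\<Sum>i\<le>l. g i) = g 0 + (\<Sum>i = 1..l. g i)" for g :: "nat \<Rightarrow> nat"
    by (induction l) auto
  have "(\<Sum>w\<in>V. f (lev w)) = (\<Sum>i\<le>l + 2. \<Sum>w\<in>{w \<in> V. lev w = i}. f (lev w))"
    using level_le by (intro sum.group[symmetric] finite_V) auto
  also have "\<dots> = (\<Sum>i\<le>l + 2. card (level V lev i) * f i)"
    by (intro sum.cong) (auto simp: level_def)
  also have "\<dots> = card (level V lev 0) * f 0 + (\<Sum>i = 1..l. card (level V lev i) * f i)
      + a * f (l + 1) + b * f (l + 2)"
    using card_level_a card_level_b by (simp add: split)
  also have "(\<Sum>i = 1..l. card (level V lev i) * f i) = \<kappa> * (\<Sum>i = 1..l. f i)"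
    by (simp add: card_level_\<kappa> sum_distrib_left)
  finally show ?thesis using card_level_0 by simp
qed

lemma card_V: "card V = 1 + \<kappa> * l + a + b"
  using sum_levels[of "\<lambda>_. 1"] by simp

lemma sum_lev: "2 * (\<Sum>w\<in>V. lev w) = \<kappa> * l * (l + 1) + 2 * (l + 1) * a + 2 * (l + 2) * b"
proof -
  have "2 * (\<Sum>i = 1..l. i) = l * (l + 1)" by (induction l) auto
  then have "\<kappa> * (2 * (\<Sum>i = 1..l. i)) = \<kappa> * l * (l + 1)"
    by (simp only: mult.assoc)
  then show ?thesis using sum_levels[of "\<lambda>i. i"] by (simp add: algebra_simps)
qed

lemma card_lower_eq: "j \<le> l \<Longrightarrow> card {u \<in> V. lev u < Suc j} = 1 + \<kappa> * j"
proof (induction j)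
  case 0
  then show ?case using card_level_0 by (simp add: level_def)
next
  case (Suc j)
  then show ?case
    using card_lower_Suc[OF finite_V, of lev "Suc j"] card_level_\<kappa>[of "Suc j"] by simp
qed

text \<open>Equality in \<open>weight_le\<close>: a vertex on layer at most \<open>l + 2\<close> has
  only layers up to \<open>l\<close> two or more below it, and these have the exact sizes 1 and
  \<kappa>.\<close>

lemma weight_eq:
  assumes "w \<in> V"
  shows "int \<kappa> * int (lev w) - int (card {u \<in> V. lev u + 2 \<le> lev w})
    = (if lev w = 0 then 0 else if lev w = 1 then int \<kappa> else 2 * int \<kappa> - 1)"
proof (cases "lev w \<le> 1")
  case True
  then show ?thesis by (auto simp: le_Suc_eq)
next
  case False
  then obtain j where j: "lev w = Suc (Suc j)" by (metis One_nat_def le_SucI not0_implies_Suc order.refl)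
  then have "card {u \<in> V. lev u + 2 \<le> lev w} = 1 + \<kappa> * j"
    using card_lower_eq[of j] level_le[OF assms] by (simp add: less_Suc_eq_le)
  then show ?thesis using j by (simp add: algebra_simps)
qed

text \<open>The weights are exact and layer 1 has exactly \<kappa> vertices, so no estimate loses
  anything. For fixed order, the sum of the levels thus determines the size.\<close>

lemma sum_lev_usize:
  "2 * int \<kappa> * int (\<Sum>w\<in>V. lev w) + 2 * int (usize (level_graph V lev)) = size_const \<kappa> (card V)"
proof -
  have "(\<Sum>w\<in>V. int \<kappa> * int (lev w) - int (card {u \<in> V. lev u + 2 \<le> lev w}))
      = (\<Sum>w\<in>V. if lev w = 0 then 0 else if lev w = 1 then int \<kappa> else 2 * int \<kappa> - 1)"
    by (intro sum.cong weight_eq refl)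
  also have "\<dots> = (2 * int \<kappa> - 1) * int (card V) - (2 * int \<kappa> - 1) - (int \<kappa> - 1) * int \<kappa>"
    using sum_level_weights[OF finite_V, of lev "int \<kappa>" "2 * int \<kappa> - 1"] card_level_0 card_level_\<kappa>[of 1] l_pos
    by simp
  finally have "2 * int \<kappa> * (\<Sum>w\<in>V. int (lev w)) + int (card (close_pairs V lev)) = size_const \<kappa> (card V)"
    unfolding sum_lev_close_pairs[OF finite_V] by (simp add: size_const_def algebra_simps)
  moreover have "int (card (close_pairs V lev)) = 2 * int (usize (level_graph V lev))"
    using usize_level_graph[OF finite_V, of lev] by simp
  ultimately show ?thesis by simp
qed

text \<open>The exchange step: one vertex moves up by one layer and the result is again
  path-complete.\<close>

lemma raise_level:
  assumes "\<not> (a = \<kappa> \<and> b \<le> \<kappa>)"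
  obtains l' a' b' lev' where "path_complete_levels \<kappa> l' a' b' V lev'"
    "(\<Sum>w\<in>V. lev' w) = (\<Sum>w\<in>V. lev w) + 1"
proof -
  \<comment> \<open>Layer \<open>l + 1\<close> can spare a vertex only if it has more than \<kappa>;
    otherwise the vertex is taken from the last layer.\<close>
  define j where "j = (if \<kappa> < a then l + 1 else l + 2)"
  have "card (level V lev j) \<noteq> 0"
    using card_level_a card_level_b b_pos \<kappa>_le_a \<kappa>_pos by (auto simp: j_def)
  then obtain x where x: "x \<in> V" "lev x = j" by (metis (mono_tags) card.empty equals0I level_def mem_Collect_eq)
  define lev' where "lev' = lev(x := j + 1)"
  have level': "level V lev' i =
    (if i = j then level V lev j - {x} else if i = j + 1 then insert x (level V lev (j + 1)) else level V lev i)" for i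
    using x by (auto simp: level_def lev'_def)
  have "card (level V lev' i) =
    (if i = j then card (level V lev j) - 1 else if i = j + 1 then card (level V lev (j + 1)) + 1
      else card (level V lev i))" for i
    using x finite_V unfolding level' by (auto simp: level_def card_insert_if)
  note card' = this
  have "(\<Sum>w\<in>V. lev' w) = (\<Sum>w\<in>V. lev w + of_bool (w = x))"
    using x by (intro sum.cong) (auto simp: lev'_def)
  also have "\<dots> = (\<Sum>w\<in>V. lev w) + 1"
    using x finite_V by (simp add: sum.distrib of_bool_def)
  finally have sum': "(\<Sum>w\<in>V. lev' w) = (\<Sum>w\<in>V. lev w) + 1" .
  show thesis
  proof (cases "\<kappa> < a")
    case True
    then have "path_complete_levels \<kappa> l (a - 1) (b + 1) V lev'"
      using \<kappa>_pos l_pos finite_V level_le card_level_0 card_level_\<kappa> card_level_a card_level_b card'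
      by unfold_locales (auto simp: j_def lev'_def)
    then show ?thesis using that sum' by blast
  next
    case False
    then have "a = \<kappa>" "\<kappa> < b" using assms \<kappa>_le_a by auto
    moreover have "level V lev (l + 3) = {}" using level_le by (fastforce simp: level_def)
    moreover have "lev' w \<le> l + 3" if "w \<in> V" for w
      using level_le[OF that] False by (auto simp: lev'_def j_def)
    \<comment> \<open>The moved vertex opens a new last layer. The old \<open>K\<^sub>a\<close>
      becomes one more copy of \<open>K\<^sub>\<kappa>\<close>, and the old last layer, now of size
      \<open>b - 1 \<ge> \<kappa>\<close>, takes the place of \<open>K\<^sub>a\<close>.\<close>
    ultimately have "path_complete_levels \<kappa> (l + 1) (b - 1) 1 V lev'"
      using \<kappa>_pos l_pos finite_V card_level_0 card_level_\<kappa> card_level_a card_level_b card' False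
      by unfold_locales (auto simp: j_def le_Suc_eq numeral_eq_Suc)
    then show ?thesis using that sum' by blast
  qed
qed

end

text \<open>Raising a vertex costs exactly \<kappa> edges, so with a surplus of \<kappa> it would
  produce a smaller graph that still has size at least \<open>m\<close>.\<close>

lemma is_PK_extremal:
  assumes "is_PK \<kappa> n m G" "path_complete_levels \<kappa> l a b V lev" "G = level_graph V lev"
    and "m + \<kappa> \<le> usize G"
  shows "a = \<kappa> \<and> b \<le> \<kappa>"
proof (rule ccontr)
  interpret path_complete_levels \<kappa> l a b V lev by fact
  assume "\<not> (a = \<kappa> \<and> b \<le> \<kappa>)"
  then obtain l' a' b' lev' where pc': "path_complete_levels \<kappa> l' a' b' V lev'"
    and sum': "(\<Sum>w\<in>V. lev' w) = (\<Sum>w\<in>V. lev w) + 1"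
    by (rule raise_level)
  interpret L': path_complete_levels \<kappa> l' a' b' V lev' by fact
  let ?H = "level_graph V lev'"
  have "int \<kappa> * int (\<Sum>w\<in>V. lev' w) = int \<kappa> * int (\<Sum>w\<in>V. lev w) + int \<kappa>"
    unfolding sum' by (simp add: algebra_simps)
  with sum_lev_usize L'.sum_lev_usize have "int (usize ?H) + int \<kappa> = int (usize G)"
    unfolding assms(3) by linarith
  then have H: "usize ?H + \<kappa> = usize G" by linarith
  have "uverts ?H = V" "uverts G = V" by (simp_all add: assms(3) level_graph_def)
  then have "path_complete \<kappa> ?H"
    using pc' path_complete_iff[OF \<kappa>_pos, of ?H] by auto
  moreover have "card (uverts ?H) = n"
    using assms(1) \<open>uverts ?H = V\<close> \<open>uverts G = V\<close> by (simp add: is_PK_def is_arg_min_def)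
  moreover have "m \<le> usize ?H" "usize ?H < usize G" using H assms(4) \<kappa>_pos by auto
  ultimately show False
    using assms(1) unfolding is_PK_def is_arg_min_def by blast
qed

section \<open>Remoteness\<close>

text \<open>A digraph with a larger distance sum would force the minimiser into the form without
  exchange, where the bound from the order alone already excludes it.\<close>

lemma is_PK_sum_path_dist_le:
  assumes PK: "is_PK \<kappa> n m G" "path_complete_levels \<kappa> l a b V lev" "G = level_graph V lev"
    and D: "admissible \<kappa> n m D" and v: "v \<in> verts D"
  shows "(\<Sum>w\<in>verts D. path_dist D v w) \<le> (\<Sum>w\<in>V. lev w)"
proof (rule ccontr)
  interpret path_complete_levels \<kappa> l a b V lev by fact
  have n: "card V = n"
    using PK(1,3) by (simp add: is_PK_def is_arg_min_def level_graph_def)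
  then have "\<kappa> < n" using card_V b_pos \<kappa>_le_a by simp
  note bounds = admissible_sum_path_dist[OF D \<kappa>_pos \<open>\<kappa> < n\<close> v]
  let ?T = "\<Sum>w\<in>verts D. path_dist D v w"
  assume less: "\<not> ?T \<le> (\<Sum>w\<in>V. lev w)"
  then have "int (\<Sum>w\<in>V. lev w) + 1 \<le> int ?T" by linarith
  then have "int \<kappa> * (int (\<Sum>w\<in>V. lev w) + 1) \<le> int \<kappa> * int ?T"
    by (intro mult_left_mono) auto
  then have "int \<kappa> * int (\<Sum>w\<in>V. lev w) + int \<kappa> \<le> int \<kappa> * int ?T"
    by (simp only: distrib_left mult_1_right)
  \<comment> \<open>Both size relations share \<open>size_const\<close>, so one more unit of
    distance forces a surplus of at least \<kappa> edges in \<open>G\<close>.\<close>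
  with bounds(1) sum_lev_usize have "int m + int \<kappa> \<le> int (usize G)"
    unfolding n PK(3) by linarith
  then have "a = \<kappa> \<and> b \<le> \<kappa>"
    using is_PK_extremal[OF PK] by linarith
  \<comment> \<open>With \<open>a = \<kappa>\<close> there are \<open>l + 1\<close> layers of size
    \<kappa>, hence \<open>L = l + 1\<close>.\<close>
  then have "2 * ?T \<le> \<kappa> * (l + 1) * (l + 1 + 1) + 2 * (l + 1 + 1) * b"
    using card_V n by (intro bounds(2)) auto
  also have "\<dots> = 2 * (\<Sum>w\<in>V. lev w)"
    unfolding sum_lev using \<open>a = \<kappa> \<and> b \<le> \<kappa>\<close> by (simp add: algebra_simps)
  finally show False using less by simp
qed

section \<open>Remoteness from distance sums, and closed forms\<close>

lemma remoteness_le: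
  assumes "finite (verts D)" "verts D \<noteq> {}" "1 < card (verts D)"
    and "\<And>v. v \<in> verts D \<Longrightarrow> (\<Sum>w\<in>verts D. path_dist D v w) \<le> T"
  shows "remoteness D \<le> real T / (real (card (verts D)) - 1)"
proof -
  have "1 / (real (card (verts D)) - 1) * (\<Sum>w\<in>verts D. real (path_dist D v w))
      \<le> real T / (real (card (verts D)) - 1)" if "v \<in> verts D" for v
  proof -
    have "(\<Sum>w\<in>verts D. real (path_dist D v w)) \<le> real T"
      using assms(4)[OF that] by (simp flip: of_nat_sum)
    then show ?thesis using assms(3) by (simp add: divide_right_mono)
  qed
  then show ?thesis
    unfolding remoteness_def using assms(1,2) by (subst Max_le_iff) auto
qed

lemma remoteness_ge:
  assumes "finite (verts D)" "1 < card (verts D)" "v \<in> verts D"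
    and "T \<le> (\<Sum>w\<in>verts D. path_dist D v w)"
  shows "real T / (real (card (verts D)) - 1) \<le> remoteness D"
proof -
  have "real T \<le> (\<Sum>w\<in>verts D. real (path_dist D v w))"
    using assms(4) by (simp flip: of_nat_sum)
  then have "real T / (real (card (verts D)) - 1)
      \<le> 1 / (real (card (verts D)) - 1) * (\<Sum>w\<in>verts D. real (path_dist D v w))"
    using assms(2) by (simp add: divide_right_mono)
  also have "\<dots> \<le> remoteness D"
    unfolding remoteness_def using assms(1,3) by (intro Max_ge) auto
  finally show ?thesis .
qed

lemma (in path_complete_levels) sum_lev_eq_rem_bound:
  "real (\<Sum>w\<in>V. lev w) / (real (card V) - 1) = rem_bound \<kappa> (card V) (usize (level_graph V lev))"
proof -
  define T N m k where "T = real (\<Sum>w\<in>V. lev w)" and "N = real (card V)"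
    and "m = real (usize (level_graph V lev))" and "k = real \<kappa>"
  have "real_of_int (2 * int \<kappa> * int (\<Sum>w\<in>V. lev w) + 2 * int (usize (level_graph V lev)))
      = real_of_int (size_const \<kappa> (card V))"
    using sum_lev_usize by simp
  then have *: "2 * k * T + 2 * m = N * (N - 1) + 2 * (2 * k - 1) * (N - 1) - 2 * k * (k - 1)"
    by (simp add: T_def N_def m_def k_def size_const_def del: of_nat_sum)
  have "1 < card V" using card_V b_pos by simp
  then have "k \<noteq> 0" "N - 1 \<noteq> 0"
    using \<kappa>_pos by (auto simp: k_def N_def)
  have "T = (N * (N - 1) + 2 * (2 * k - 1) * (N - 1) - 2 * k * (k - 1) - 2 * m) / (2 * k)"
    using * \<open>k \<noteq> 0\<close> by (simp add: eq_divide_eq algebra_simps)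
  also have "\<dots> = (N / (2 * k) + 2 - 1 / k) * (N - 1) - (k - 1) - m / k"
    using \<open>k \<noteq> 0\<close> by (simp add: field_simps)
  finally have "T = (N / (2 * k) + 2 - 1 / k) * (N - 1) - (k - 1) - m / k" .
  then have "T / (N - 1) = N / (2 * k) + 2 - 1 / k - (k - 1) / (N - 1) - m / (k * (N - 1))"
    using \<open>N - 1 \<noteq> 0\<close> by (simp add: diff_divide_distrib)
  then show ?thesis by (simp add: rem_bound_def T_def N_def m_def k_def)
qed

text \<open>Identifies the lower limit on \<open>m0\<close> in the sharpness condition as the size
  of the graph in which no vertex can be raised.\<close>

lemma (in path_complete_levels) extremal_usize:
  assumes "a = \<kappa>" "b \<le> \<kappa>"
  shows "real (usize (level_graph V lev)) =
    1 / 2 * (real (card V) * (3 * real \<kappa> - 1) - 2 * (real \<kappa>)\<^sup>2 - real \<kappa> + 1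
      - real b * (real \<kappa> - real b))"
proof -
  define T m k L B where "T = real (\<Sum>w\<in>V. lev w)"
    and "m = real (usize (level_graph V lev))" and "k = real \<kappa>" and "L = real l" and "B = real b"
  have N: "real (card V) = 1 + k * L + k + B"
    using card_V assms(1) by (simp add: k_def L_def B_def)
  have "real_of_int (2 * int \<kappa> * int (\<Sum>w\<in>V. lev w) + 2 * int (usize (level_graph V lev)))
      = real_of_int (size_const \<kappa> (card V))"
    using sum_lev_usize by simp
  then have *: "k * (2 * T) + 2 * m = real (card V) * (real (card V) - 1)
      + 2 * (2 * k - 1) * (real (card V) - 1) - 2 * k * (k - 1)"
    by (simp add: T_def m_def k_def size_const_def del: of_nat_sum)
  have "real (2 * (\<Sum>w\<in>V. lev w)) = real (\<kappa> * l * (l + 1) + 2 * (l + 1) * a + 2 * (l + 2) * b)"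
    using sum_lev by (simp only:)
  then have T: "2 * T = k * L * (L + 1) + 2 * (L + 1) * k + 2 * (L + 2) * B"
    using assms(1) by (simp add: T_def k_def L_def B_def algebra_simps del: of_nat_sum)
  from * have "2 * m = real (card V) * (3 * k - 1) - 2 * k\<^sup>2 - k + 1 - B * (k - B)"
    unfolding N T by (simp add: algebra_simps power2_eq_square)
  then show ?thesis by (simp add: m_def k_def B_def)
qed

text \<open>With \<open>N = n - 1\<close>, the constant \<open>size_const\<close> is N(N - 1) plus a
  multiple of 2\<kappa>, so halving \<open>sum_lev_usize\<close> leaves a multiple of
  \<kappa>.\<close>

lemma (in path_complete_levels) usize_cong:
  "[usize (level_graph V lev) = (card V - 1) choose 2] (mod \<kappa>)"
proof -
  define N where "N = card V - 1"
  have N: "int (card V) = int N + 1" using card_V by (simp add: N_def)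
  have "even (N * (N - 1))" by (cases N) auto
  then have "2 * (N choose 2) = N * (N - 1)" by (simp add: choose_two)
  then have "int (2 * (N choose 2)) = int (N * (N - 1))" by simp
  then have ch: "2 * int (N choose 2) = int N * (int N - 1)"
    using N by (cases N) (auto simp: algebra_simps)
  have "2 * int (usize (level_graph V lev)) - 2 * int (N choose 2)
      = 2 * (int \<kappa> * (2 * int N - (int \<kappa> - 1) - int (\<Sum>w\<in>V. lev w)))"
    using sum_lev_usize unfolding ch size_const_def N by (simp add: algebra_simps)
  then have "int (usize (level_graph V lev)) - int (N choose 2)
      = int \<kappa> * (2 * int N - (int \<kappa> - 1) - int (\<Sum>w\<in>V. lev w))"
    by linarith
  then have "int \<kappa> dvd int (usize (level_graph V lev)) - int (N choose 2)"
    by simp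
  then show ?thesis
    unfolding N_def[symmetric] cong_int_iff[symmetric] by (simp add: cong_iff_dvd_diff)
qed

section \<open>The remoteness bound and its sharpness\<close>

theorem theorem4p3:
  fixes \<kappa> n m0 :: nat and PK :: "'v ugraph"
  assumes "1 \<le> \<kappa>" and "1 \<le> n" and "1 \<le> m0"
    and "is_PK \<kappa> n m0 PK"
  shows "(\<forall>D :: ('a, 'b) pre_digraph. admissible \<kappa> n m0 D \<longrightarrow>
            remoteness D \<le> remoteness (bidirected PK))
    \<and> (\<exists>D :: ('v, 'v \<times> 'v) pre_digraph. admissible \<kappa> n m0 D \<and>
            remoteness D = remoteness (bidirected PK))
    \<and> remoteness (bidirected PK) = rem_bound \<kappa> n (usize PK)
    \<and> remoteness (bidirected PK) \<le> rem_bound \<kappa> n m0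
    \<and> (\<forall>b \<in> {1..\<kappa>}.
          [b = n - 1] (mod \<kappa>) \<and> [m0 = (n - 1) choose 2] (mod \<kappa>) \<and>
          1 / 2 * (real n * (3 * real \<kappa> - 1) - 2 * (real \<kappa>)\<^sup>2 - real \<kappa> + 1
                    - real b * (real \<kappa> - real b)) \<le> real m0 \<and>
          m0 \<le> (n - 1) choose 2
          \<longrightarrow> remoteness (bidirected PK) = rem_bound \<kappa> n m0 \<and>
              (\<exists>D :: ('v, 'v \<times> 'v) pre_digraph. admissible \<kappa> n m0 D \<and>
                 remoteness D = rem_bound \<kappa> n m0))"
proof -
  have pc: "path_complete \<kappa> PK" and n: "card (uverts PK) = n" and m0: "m0 \<le> usize PK"
    using assms(4) by (auto simp: is_PK_def is_arg_min_def)
  obtain l a b' lev where pcl: "path_complete_levels \<kappa> l a b' (uverts PK) lev"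
    and PK: "PK = level_graph (uverts PK) lev"
    using pc path_complete_iff[OF assms(1)] by blast
  define V where "V = uverts PK"
  note pcl = pcl[folded V_def] and PK = PK[folded V_def] and n = n[folded V_def]
  interpret path_complete_levels \<kappa> l a b' V lev by (fact pcl)
  define T where "T = (\<Sum>w\<in>V. lev w)"
  let ?P = "bidirected PK"
  have n_gt: "\<kappa> < n" "1 < n" using card_V b_pos \<kappa>_le_a \<kappa>_pos n by auto
  have adm: "admissible \<kappa> n m0 ?P"
    using admissible_level_graph[of m0] m0 n_gt n PK by simp
  \<comment> \<open>The types are kept generic because the bound is also applied to
    \<open>?P\<close> itself.\<close>
  have upper: "remoteness D \<le> real T / (real n - 1)"
    if D: "admissible \<kappa> n m0 D" for D :: "('c, 'd) pre_digraph"
  proof -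
    have card: "card (verts D) = n" and "eulerian_digraph D" using D by (auto simp: admissible_def)
    then interpret digraph D by (simp add: eulerian_digraph_def)
    have "remoteness D \<le> real T / (real (card (verts D)) - 1)"
      using is_PK_sum_path_dist_le[OF assms(4) pcl PK D] card n_gt
      by (intro remoteness_le) (auto simp: T_def)
    then show ?thesis by (simp add: card)
  qed
  have vP: "verts ?P = V" by (simp add: PK bidirected_level_graph)
  have "real T / (real n - 1) \<le> remoteness ?P"
  proof -
    have sc: "strongly_connected ?P" and dg: "digraph ?P"
      using adm by (auto simp: admissible_def eulerian_digraph_def)
    interpret P: digraph ?P by (rule dg)
    have "level V lev 0 \<noteq> {}" using card_level_0 by auto
    then obtain v where v: "v \<in> V" "lev v = 0" by (auto simp: level_def)
    \<comment> \<open>Levels rise by at most one along arcs and start at 0 in \<open>v\<close>, so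
      they bound the distances from \<open>v\<close> from below.\<close>
    have "lev w \<le> path_dist ?P v w" if "w \<in> V" for w
      using P.potential_le_path_dist[of lev v w] that v vP sc
      by (auto simp: strongly_connected_def PK bidirected_level_graph close_pairs_def)
    then have "T \<le> (\<Sum>w\<in>verts ?P. path_dist ?P v w)"
      unfolding T_def vP by (rule sum_mono)
    then have "real T / (real (card (verts ?P)) - 1) \<le> remoteness ?P"
      using v vP n n_gt by (intro remoteness_ge) auto
    then show ?thesis by (simp add: vP n)
  qed
  with upper[OF adm] have remP: "remoteness ?P = real T / (real n - 1)" by simp
  then have rem_eq: "remoteness ?P = rem_bound \<kappa> n (usize PK)"
    using sum_lev_eq_rem_bound by (simp add: T_def n PK)
  have "rem_bound \<kappa> n (usize PK) \<le> rem_bound \<kappa> n m0"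
    using m0 n_gt \<kappa>_pos by (auto simp: rem_bound_def intro!: divide_right_mono)
  then have rem_le: "remoteness ?P \<le> rem_bound \<kappa> n m0" using rem_eq by simp
  \<comment> \<open>The surplus over \<open>m0\<close> is a multiple of \<kappa>. If it were
    positive, \<open>PK\<close> would be the graph without exchange, whose size is the lower limit
    and hence at most \<open>m0\<close>.\<close>
  have size_eq: "usize PK = m0"
    if b: "b \<in> {1..\<kappa>}" "[b = n - 1] (mod \<kappa>)" and m_cong: "[m0 = (n - 1) choose 2] (mod \<kappa>)"
      and lower: "1 / 2 * (real n * (3 * real \<kappa> - 1) - 2 * (real \<kappa>)\<^sup>2 - real \<kappa> + 1
        - real b * (real \<kappa> - real b)) \<le> real m0" for b
  proof (rule ccontr)
    assume "usize PK \<noteq> m0"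
    with m0 have less: "m0 < usize PK" by simp
    have "[usize PK = m0] (mod \<kappa>)"
      using cong_trans[OF usize_cong[unfolded n PK[symmetric]] cong_sym[OF m_cong]] .
    then have "\<kappa> dvd usize PK - m0"
      using less by (simp add: cong_altdef_nat)
    then have "\<kappa> \<le> usize PK - m0" using less by (intro dvd_imp_le) auto
    with less have "m0 + \<kappa> \<le> usize PK" by simp
    then have ext: "a = \<kappa>" "b' \<le> \<kappa>" using is_PK_extremal[OF assms(4) pcl PK] by auto
    have "n - 1 = b' + \<kappa> * (l + 1)" using card_V n ext by simp
    then have "[b = b'] (mod \<kappa>)" using b(2) by (simp only: cong_def mod_mult_self2)
    then have "b = b'"
    proof -
      \<comment> \<open>Shifting by one moves both numbers from 1..\<kappa> to 0..\<kappa>-1, where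
        congruence implies equality.\<close>
      have "[b - 1 = b' - 1] (mod \<kappa>)"
        using \<open>[b = b'] (mod \<kappa>)\<close> b(1) b_pos
        by (metis atLeastAtMost_iff cong_add_rcancel_nat le_add_diff_inverse2)
      then have "b - 1 = b' - 1"
        using b(1) b_pos ext by (intro cong_less_modulus_unique_nat) auto
      then show ?thesis using b(1) b_pos by auto
    qed
    then have "real (usize PK) \<le> real m0"
      using extremal_usize[OF ext] lower by (simp add: PK[symmetric] n)
    with less show False by simp
  qed
  show ?thesis
  proof (intro conjI allI ballI impI)
    fix D :: "('a, 'b) pre_digraph"
    assume "admissible \<kappa> n m0 D"
    then show "remoteness D \<le> remoteness ?P" using upper remP by simp
  next
    show "\<exists>D :: ('v, 'v \<times> 'v) pre_digraph. admissible \<kappa> n m0 D \<and> remoteness D = remoteness ?P"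
      using adm by blast
  next
    show "remoteness ?P = rem_bound \<kappa> n (usize PK)" by (fact rem_eq)
  next
    show "remoteness ?P \<le> rem_bound \<kappa> n m0" by (fact rem_le)
  next
    fix b
    assume "b \<in> {1..\<kappa>}" and "[b = n - 1] (mod \<kappa>) \<and> [m0 = (n - 1) choose 2] (mod \<kappa>) \<and>
      1 / 2 * (real n * (3 * real \<kappa> - 1) - 2 * (real \<kappa>)\<^sup>2 - real \<kappa> + 1
        - real b * (real \<kappa> - real b)) \<le> real m0 \<and> m0 \<le> (n - 1) choose 2"
    then have "usize PK = m0" using size_eq by blast
    then show rem: "remoteness ?P = rem_bound \<kappa> n m0" using rem_eq by simp
    then show "\<exists>D :: ('v, 'v \<times> 'v) pre_digraph. admissible \<kappa> n m0 D \<and>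
        remoteness D = rem_bound \<kappa> n m0"
      using adm by blast
  qed
qed

end
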